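(* Let $M$ be a set with a binary operation $\to$ and a constant $e$ satisfying, for all $x,y,z\in M$: $x\to x=e$ (Reflexivity), $e\to x=x$ (Unit-reduction), and $(t(x,y)\to x)\to(t(x,y)\to z)=x\to z$ (M-axiom), where $t(x,y)=(x\to y)\to y$. Define $a\le b$ iff $a\to b=e$. \begin{enumerate} \item For all $a,b\in M$, $a\le b$ implies $t(a,b)=b$; and $\le$ is a preorder on $M$. \item Assume moreover that $\to$ is increasing in its second argument (i.e. $b\le c$ implies $(a\to b)\le(a\to c)$) and that $M$ satisfies Implicative commutativity $x\to(y\to z)=y\to(x\to z)$. Then $\to$ is decreasing in its first argument (i.e. $a\le b$ implies $(b\to c)\le(a\to c)$). Moreover, $t$ is a pre-order term and a relative closure term in $M$: writing $u\le_t w$ for $t(u,w)=w$, $\bar x=t(x,y)$ and $\bar{\bar x}=t(t(x,y),z)$, the algebra $M$ satisfies for all $x,y,z$: \begin{itemize} \item $t(x,x)=x$ and $t(x,t(t(x,y),z))=t(t(x,y),z)$; \item $t(x,\bar x)=\bar x$ (Left-absorption); \item $t(\bar x,y)\le_t \bar x$ (Right-absorption); \item $t(x,z)\le_t t(\bar x,z)$ (Left-monotonicity); \item $t(\bar x,t(x,z))=t(\bar x,z)$ (Flattening); \item $t(t(\bar{\bar x},\bar x),x)\le_t t(\bar{\bar x},x)$ (Closure stability). \end{itemize} \end{enumerate} *)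

theory Defs
  imports Main
begin

definition impl_t :: "('a \<Rightarrow> 'a \<Rightarrow> 'a) \<Rightarrow> 'a \<Rightarrow> 'a \<Rightarrow> 'a" where
  "impl_t imp x y = imp (imp x y) y"

definition impl_le :: "('a \<Rightarrow> 'a \<Rightarrow> 'a) \<Rightarrow> 'a \<Rightarrow> 'a \<Rightarrow> 'a \<Rightarrow> bool" where
  "impl_le imp e a b \<longleftrightarrow> imp a b = e"

definition term_le :: "('a \<Rightarrow> 'a \<Rightarrow> 'a) \<Rightarrow> 'a \<Rightarrow> 'a \<Rightarrow> bool" where
  "term_le t u w \<longleftrightarrow> t u w = w"

definition preorder_term :: "('a \<Rightarrow> 'a \<Rightarrow> 'a) \<Rightarrow> bool" where
  "preorder_term t \<longleftrightarrow>
     (\<forall>x. t x x = x) \<and>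
     (\<forall>x y z. t x (t (t x y) z) = t (t x y) z)"

text \<open>The conjuncts are, in order: left-absorption, right-absorption,
  left-monotonicity, flattening, closure stability.\<close>

definition relative_closure_term :: "('a \<Rightarrow> 'a \<Rightarrow> 'a) \<Rightarrow> bool" where
  "relative_closure_term t \<longleftrightarrow>
     (\<forall>x y. t x (t x y) = t x y) \<and>
     (\<forall>x y. term_le t (t (t x y) y) (t x y)) \<and>
     (\<forall>x y z. term_le t (t x z) (t (t x y) z)) \<and>
     (\<forall>x y z. t (t x y) (t x z) = t (t x y) z) \<and>
     (\<forall>x y z. term_le t (t (t (t (t x y) z) (t x y)) x) (t (t (t x y) z) x))"

end

theory Submission
  imports Defs
begin

text \<open>
  If \<open>a \<le> b\<close> then \<open>t(a,b) = b\<close>, so the M-axiom becomes the relative law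
  \<open>(b \<rightarrow> a) \<rightarrow> (b \<rightarrow> c) = a \<rightarrow> c\<close>. Together with commutativity
  it yields \<open>x \<le> t(x,y)\<close>, antitonicity of \<open>\<rightarrow>\<close> in its first argument and flattening.
  The relation \<open>\<le>\<close> need not be antisymmetric, but the relative law shows that equivalent
  elements can be exchanged in the first argument of \<open>\<rightarrow>\<close>, which gives right-absorption.
  Monotonicity in the second argument enters only in closure stability, through
  \<open>q \<rightarrow> b \<le> (b \<rightarrow> x) \<rightarrow> (q \<rightarrow> x)\<close>.
\<close>

locale M_algebra =
  fixes imp :: "'a \<Rightarrow> 'a \<Rightarrow> 'a" (infixr \<open>\<rightarrow>\<close> 60) and e :: 'a
  assumes reflexivity: "x \<rightarrow> x = e"
    and unit_reduction: "e \<rightarrow> x = x"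
    and M_axiom: "(impl_t imp x y \<rightarrow> x) \<rightarrow> (impl_t imp x y \<rightarrow> z) = x \<rightarrow> z"
begin

abbreviation t :: "'a \<Rightarrow> 'a \<Rightarrow> 'a" where "t \<equiv> impl_t imp"

abbreviation le :: "'a \<Rightarrow> 'a \<Rightarrow> bool" (infix \<open>\<sqsubseteq>\<close> 50) where "le \<equiv> impl_le imp e"

lemma t_absorb: "a \<sqsubseteq> b \<Longrightarrow> t a b = b"
  by (simp add: impl_t_def impl_le_def unit_reduction)

lemma relative_law: "a \<sqsubseteq> b \<Longrightarrow> (b \<rightarrow> a) \<rightarrow> (b \<rightarrow> c) = a \<rightarrow> c"
  using M_axiom[of a b c] by (simp add: t_absorb)

text \<open>Case \<open>c = b\<close> of the relative law. It lets the premise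
  \<open>b \<rightarrow> a\<close> be discharged in front of \<open>e\<close>.\<close>

lemma converse_imp_unit: "a \<sqsubseteq> b \<Longrightarrow> (b \<rightarrow> a) \<rightarrow> e = e"
  using relative_law[of a b b] by (simp add: reflexivity impl_le_def)

lemma le_refl: "a \<sqsubseteq> a"
  by (simp add: impl_le_def reflexivity)

text \<open>As \<open>b \<rightarrow> c = e\<close>, the relative law reads
  \<open>(b \<rightarrow> a) \<rightarrow> e = a \<rightarrow> c\<close>, and its left side is
  \<open>e\<close>.\<close>

lemma le_trans: "a \<sqsubseteq> b \<Longrightarrow> b \<sqsubseteq> c \<Longrightarrow> a \<sqsubseteq> c"
  using relative_law[of a b c] converse_imp_unit[of a b] by (simp add: impl_le_def)

lemma imp_cong_left: "a \<sqsubseteq> b \<Longrightarrow> b \<sqsubseteq> a \<Longrightarrow> a \<rightarrow> c = b \<rightarrow> c"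
  using relative_law[of a b c] by (simp add: impl_le_def unit_reduction)

end

locale commutative_M_algebra = M_algebra +
  assumes imp_commute: "x \<rightarrow> y \<rightarrow> z = y \<rightarrow> x \<rightarrow> z"
begin

lemma imp_antimono_left:
  assumes "a \<sqsubseteq> b"
  shows "b \<rightarrow> c \<sqsubseteq> a \<rightarrow> c"
proof -
  have "(b \<rightarrow> c) \<rightarrow> (a \<rightarrow> c) = (b \<rightarrow> c) \<rightarrow> (b \<rightarrow> a) \<rightarrow> (b \<rightarrow> c)"
    using relative_law[OF assms] by simp
  also have "\<dots> = (b \<rightarrow> a) \<rightarrow> (b \<rightarrow> c) \<rightarrow> (b \<rightarrow> c)"
    by (rule imp_commute)
  also have "\<dots> = e"
    using converse_imp_unit[OF assms] by (simp add: reflexivity)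
  finally show ?thesis by (simp add: impl_le_def)
qed

text \<open>Swapping the premises \<open>x\<close> and \<open>x \<rightarrow> y\<close> leaves an
  instance of reflexivity.\<close>

lemma le_t: "x \<sqsubseteq> t x y"
  using imp_commute[of x "x \<rightarrow> y" y] by (simp add: impl_le_def impl_t_def reflexivity)

lemma t_mono_left: "a \<sqsubseteq> b \<Longrightarrow> t a c \<sqsubseteq> t b c"
  unfolding impl_t_def by (intro imp_antimono_left)

text \<open>The elements \<open>t x y \<rightarrow> y\<close> and \<open>x \<rightarrow> y\<close>
  are equivalent, hence exchangeable as first arguments.\<close>

lemma t_t_same: "t (t x y) y = t x y"
proof -
  have "t x y \<rightarrow> y \<sqsubseteq> x \<rightarrow> y"
    by (intro imp_antimono_left le_t)
  moreover have "x \<rightarrow> y \<sqsubseteq> t x y \<rightarrow> y"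
    using le_t[of "x \<rightarrow> y" y] by (simp add: impl_t_def)
  ultimately show ?thesis
    unfolding impl_t_def by (rule imp_cong_left)
qed

lemma t_flatten:
  assumes "a \<sqsubseteq> b"
  shows "t b (t a c) = t b c"
proof -
  let ?p = "b \<rightarrow> c" and ?q = "a \<rightarrow> c"
  \<comment> \<open>Swapping premises in \<open>b \<rightarrow> ?q \<rightarrow> c\<close> gives
    \<open>?q \<rightarrow> ?p\<close>.\<close>
  have "t b (t a c) = (?q \<rightarrow> ?p) \<rightarrow> t a c"
    unfolding impl_t_def[of _ b] by (simp add: impl_t_def imp_commute[of b ?q c])
  \<comment> \<open>Antitonicity gives \<open>?p \<sqsubseteq> ?q\<close>, so the relative law
    cancels the common premise \<open>?q\<close>.\<close>
  also have "\<dots> = ?p \<rightarrow> c"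
    using relative_law[OF imp_antimono_left[OF assms]] by (simp add: impl_t_def)
  finally show ?thesis by (simp add: impl_t_def)
qed

text \<open>By \<open>le_t\<close> twice,
  \<open>x \<sqsubseteq> t x y \<sqsubseteq> t (t x y) z\<close>; then \<open>t_absorb\<close>
  applies.\<close>

lemma preorder_term_t: "preorder_term t"
  unfolding preorder_term_def
  by (meson t_absorb le_refl le_trans le_t)

end

locale monotone_M_algebra = commutative_M_algebra +
  assumes imp_mono_right: "b \<sqsubseteq> c \<Longrightarrow> a \<rightarrow> b \<sqsubseteq> a \<rightarrow> c"
begin

text \<open>Put the premise \<open>q\<close> before both sides of
  \<open>b \<sqsubseteq> t b x\<close>, then swap \<open>q\<close> with
  \<open>b \<rightarrow> x\<close>.\<close>

lemma imp_compose: "q \<rightarrow> b \<sqsubseteq> (b \<rightarrow> x) \<rightarrow> (q \<rightarrow> x)"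
  using imp_mono_right[OF le_t, of q b x] by (simp add: impl_t_def imp_commute[of q])

text \<open>Meant for \<open>b = t x y\<close> and \<open>a = t b z\<close>. By antitonicity it
  suffices that \<open>a \<rightarrow> x \<sqsubseteq> t a b \<rightarrow> x\<close>.\<close>

lemma closure_stability:
  assumes "x \<sqsubseteq> b" "b \<sqsubseteq> a"
  shows "t (t a b) x \<sqsubseteq> t a x"
proof -
  let ?p = "a \<rightarrow> x" and ?q = "a \<rightarrow> b"
  have pq: "?p \<sqsubseteq> ?q"
    using assms(1) by (rule imp_mono_right)
  have "?p \<rightarrow> (?q \<rightarrow> b) \<rightarrow> x = (?q \<rightarrow> b) \<rightarrow> (?p \<rightarrow> x)"
    by (rule imp_commute)
  \<comment> \<open>The relative law is read backwards to expose \<open>?q \<rightarrow> ?p\<close>,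
    which its instance for \<open>b \<sqsubseteq> a\<close> contracts to
    \<open>b \<rightarrow> x\<close>; this is the shape of \<open>imp_compose\<close>.\<close>
  also have "?p \<rightarrow> x = (?q \<rightarrow> ?p) \<rightarrow> (?q \<rightarrow> x)"
    using relative_law[OF pq] by simp
  also have "?q \<rightarrow> ?p = b \<rightarrow> x"
    using assms(2) by (rule relative_law)
  also have "(?q \<rightarrow> b) \<rightarrow> (b \<rightarrow> x) \<rightarrow> (?q \<rightarrow> x) = e"
    using imp_compose by (simp add: impl_le_def)
  finally have "?p \<sqsubseteq> t a b \<rightarrow> x"
    by (simp add: impl_le_def impl_t_def)
  then show ?thesis
    unfolding impl_t_def[of _ _ x] by (rule imp_antimono_left)
qed

lemma relative_closure_term_t: "relative_closure_term t"
  unfolding relative_closure_term_def term_le_def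
  by (simp add: t_absorb le_t le_refl t_t_same t_mono_left t_flatten closure_stability)

end

theorem mainTheorem2:
  fixes imp :: "'a \<Rightarrow> 'a \<Rightarrow> 'a" and e :: 'a
  assumes reflexivity: "\<And>x. imp x x = e"
    and unit_reduction: "\<And>x. imp e x = x"
    and M_axiom: "\<And>x y z. imp (imp (impl_t imp x y) x) (imp (impl_t imp x y) z) = imp x z"
  shows "((\<forall>a b. impl_le imp e a b \<longrightarrow> impl_t imp a b = b) \<and>
          reflp (impl_le imp e) \<and> transp (impl_le imp e)) \<and>
         ((\<forall>a b c. impl_le imp e b c \<longrightarrow> impl_le imp e (imp a b) (imp a c)) \<and>
          (\<forall>x y z. imp x (imp y z) = imp y (imp x z)) \<longrightarrow>
            (\<forall>a b c. impl_le imp e a b \<longrightarrow> impl_le imp e (imp b c) (imp a c)) \<and>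
            preorder_term (impl_t imp) \<and>
            relative_closure_term (impl_t imp))"
proof (intro conjI impI)
  interpret M_algebra imp e
    by unfold_locales (fact assms)+
  show "\<forall>a b. impl_le imp e a b \<longrightarrow> impl_t imp a b = b"
    using t_absorb by blast
  show "reflp (impl_le imp e)"
    using le_refl by (rule reflpI)
  show "transp (impl_le imp e)"
    using le_trans by (rule transpI)
  assume "(\<forall>a b c. impl_le imp e b c \<longrightarrow> impl_le imp e (imp a b) (imp a c)) \<and>
          (\<forall>x y z. imp x (imp y z) = imp y (imp x z))"
  then interpret monotone_M_algebra imp e
    by unfold_locales blast+
  show "\<forall>a b c. impl_le imp e a b \<longrightarrow> impl_le imp e (imp b c) (imp a c)"
    using imp_antimono_left by blast
  show "preorder_term (impl_t imp)"
    by (rule preorder_term_t)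
  show "relative_closure_term (impl_t imp)"
    by (rule relative_closure_term_t)
qed

end
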